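(* For all integers $r\ge 3$ and $t\ge 1$, $\mathrm{cov}(r,r+t)\ge t+1$.
   Context: A complete $r$-uniform $r$-partite hypergraph $K$ has a vertex set $V=V(K)$ partitioned into nonempty classes $V_1\cup\dots\cup V_r$, and its edges are exactly the sets containing one vertex from each class. A $k$-coloring of a hypergraph is an assignment of a color from $[k]=\{1,\dots,k\}$ to each edge (not all $k$ colors need be used). A coloring is spanning if every vertex is incident to edges of every color used in the coloring. For an edge-colored hypergraph $H$, let $H_i$ be the subhypergraph on vertex set $V(H)$ consisting of the edges of color $i$. A hypergraph is connected if it has only one vertex or any two distinct vertices can be connected by a sequence of edges each intersecting the next; every hypergraph is uniquely partitioned into connected components. A monochromatic component of $H$ is (the vertex set of) a connected component of $H_i$ for some color $i$. Let $c(H)$ be the minimum integer $m$ such that $V(H)$ can be covered by $m$ monochromatic components of $H$. $\mathrm{cov}(r,k)$ is the maximum of $c(K)$ when $K$ ranges over all spanning $k$-colorings of complete $r$-uniform $r$-partite hypergraphs. *)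

theory Defs
  imports Main "HOL-Library.Disjoint_Sets"
begin

text \<open>A hypergraph is given by its vertex set \<open>V\<close> and its edge set \<open>E\<close>; a colouring \<open>f\<close> is a
  total function of which only the values on \<open>E\<close> matter. Hypergraphs are finite.\<close>

definition complete_partite :: "nat \<Rightarrow> 'a set \<Rightarrow> 'a set set \<Rightarrow> bool" where
  "complete_partite r V E \<longleftrightarrow>
     finite V \<and>
     (\<exists>P. partition_on V P \<and> card P = r \<and> E = {e. e \<subseteq> V \<and> (\<forall>A\<in>P. card (e \<inter> A) = 1)})"

definition edge_coloring :: "nat \<Rightarrow> 'a set set \<Rightarrow> ('a set \<Rightarrow> nat) \<Rightarrow> bool" where
  "edge_coloring k E f \<longleftrightarrow> (\<forall>e\<in>E. f e \<in> {1..k})"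

text \<open>Only the colours actually used, i.e. those in \<open>f ` E\<close>, have to occur at every vertex.\<close>

definition spanning :: "'a set \<Rightarrow> 'a set set \<Rightarrow> ('a set \<Rightarrow> nat) \<Rightarrow> bool" where
  "spanning V E f \<longleftrightarrow> (\<forall>v\<in>V. \<forall>i\<in>f ` E. \<exists>e\<in>E. v \<in> e \<and> f e = i)"

definition linked :: "'a set set \<Rightarrow> 'a \<Rightarrow> 'a \<Rightarrow> bool" where
  "linked E x y \<longleftrightarrow> x = y \<or>
     (\<exists>es. es \<noteq> [] \<and> set es \<subseteq> E \<and> x \<in> hd es \<and> y \<in> last es \<and>
           successively (\<lambda>e e'. e \<inter> e' \<noteq> {}) es)"

definition components :: "'a set \<Rightarrow> 'a set set \<Rightarrow> 'a set set" where
  "components V E = V // {(x, y). x \<in> V \<and> y \<in> V \<and> linked E x y}"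

definition color_edges :: "'a set set \<Rightarrow> ('a set \<Rightarrow> nat) \<Rightarrow> nat \<Rightarrow> 'a set set" where
  "color_edges E f i = {e \<in> E. f e = i}"

text \<open>An unused colour contributes the singletons, which are contained in the components of any
  used colour and hence do not affect covering numbers.\<close>

definition mono_components :: "nat \<Rightarrow> 'a set \<Rightarrow> 'a set set \<Rightarrow> ('a set \<Rightarrow> nat) \<Rightarrow> 'a set set" where
  "mono_components k V E f = (\<Union>i\<in>{1..k}. components V (color_edges E f i))"

definition cover_number :: "nat \<Rightarrow> 'a set \<Rightarrow> 'a set set \<Rightarrow> ('a set \<Rightarrow> nat) \<Rightarrow> nat" where
  "cover_number k V E f =
     (LEAST m. \<exists>C. C \<subseteq> mono_components k V E f \<and> finite C \<and> card C = m \<and> V \<subseteq> \<Union>C)"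

text \<open>Every finite hypergraph is isomorphic to one whose vertices are natural numbers, so it
  suffices to range over the latter. That the maximum exists is shown in \<open>cover_numbers_finite\<close>
  and \<open>cover_numbers_nonempty\<close> below.\<close>

definition cover_numbers :: "nat \<Rightarrow> nat \<Rightarrow> nat set" where
  "cover_numbers r k =
     {cover_number k V E f | (V :: nat set) E f.
        complete_partite r V E \<and> edge_coloring k E f \<and> spanning V E f}"

definition cov :: "nat \<Rightarrow> nat \<Rightarrow> nat" where
  "cov r k = Max (cover_numbers r k)"

lemma linked_sym: "linked E x y \<Longrightarrow> linked E y x"
  unfolding linked_def
proof (elim disjE exE conjE)
  fix es assume *: "es \<noteq> []" "set es \<subseteq> E" "x \<in> hd es" "y \<in> last es"
    "successively (\<lambda>e e'. e \<inter> e' \<noteq> {}) es"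
  have "successively (\<lambda>e e'. e \<inter> e' \<noteq> {}) (rev es)"
    using *(5) by (simp add: Int_commute)
  then show "y = x \<or> (\<exists>es. es \<noteq> [] \<and> set es \<subseteq> E \<and> y \<in> hd es \<and> x \<in> last es \<and>
      successively (\<lambda>e e'. e \<inter> e' \<noteq> {}) es)"
    using * by (intro disjI2 exI[of _ "rev es"]) (auto simp: hd_rev last_rev)
qed simp

lemma linked_trans:
  assumes "linked E x y" "linked E y z" shows "linked E x z"
proof (cases "x = y \<or> y = z")
  case False
  then obtain es fs where
    es: "es \<noteq> []" "set es \<subseteq> E" "x \<in> hd es" "y \<in> last es"
      "successively (\<lambda>e e'. e \<inter> e' \<noteq> {}) es" and
    fs: "fs \<noteq> []" "set fs \<subseteq> E" "y \<in> hd fs" "z \<in> last fs"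
      "successively (\<lambda>e e'. e \<inter> e' \<noteq> {}) fs"
    using assms unfolding linked_def by blast
  then show ?thesis
    unfolding linked_def
    by (intro disjI2 exI[of _ "es @ fs"]) (auto simp: successively_append_iff)
qed (use assms in auto)

lemma equiv_linked: "equiv V {(x, y). x \<in> V \<and> y \<in> V \<and> linked E x y}"
proof (rule equivI)
  show "refl_on V {(x, y). x \<in> V \<and> y \<in> V \<and> linked E x y}"
    by (rule refl_onI) (simp add: linked_def)
  show "sym {(x, y). x \<in> V \<and> y \<in> V \<and> linked E x y}"
    by (rule symI) (auto intro: linked_sym)
  show "trans {(x, y). x \<in> V \<and> y \<in> V \<and> linked E x y}"
    by (rule transI) (auto intro: linked_trans)
qed auto

lemma partition_on_components: "partition_on V (components V E)"
  unfolding components_def by (rule partition_on_quotient[OF equiv_linked])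

lemma complete_partite_edge:
  assumes V: "finite V" and P: "partition_on V P"
    and A: "A \<in> P" "B \<in> P" "A \<noteq> B" and x: "x \<in> A" "y \<in> B"
  shows "\<exists>e. e \<subseteq> V \<and> (\<forall>C\<in>P. card (e \<inter> C) = 1) \<and> x \<in> e \<and> y \<in> e"
proof -
  define g where "g C = (if C = A then x else if C = B then y else SOME z. z \<in> C)" for C
  have g: "g C \<in> C" if "C \<in> P" for C
    using that x partition_onD3[OF P] by (auto simp: g_def some_in_eq)
  have "(g ` P) \<inter> C = {g C}" if "C \<in> P" for C
  proof -
    have "D = C" if "D \<in> P" "g D \<in> C" for D
      using disjointD[OF partition_onD2[OF P] that(1) \<open>C \<in> P\<close>] g[OF that(1)] that(2) by auto
    then show ?thesis using g that by auto
  qed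
  moreover have "g ` P \<subseteq> V" using g partition_onD1[OF P] by auto
  moreover have "x = g A" "y = g B" using A by (auto simp: g_def)
  ultimately show ?thesis using A by (intro exI[of _ "g ` P"]) auto
qed

lemma cover_number_le:
  assumes K: "complete_partite r V E" and f: "edge_coloring k E f" and r: "2 \<le> r"
  shows "cover_number k V E f \<le> 2 * k"
proof -
  from K obtain P where P: "finite V" "partition_on V P" "card P = r"
    and E: "E = {e. e \<subseteq> V \<and> (\<forall>A\<in>P. card (e \<inter> A) = 1)}"
    unfolding complete_partite_def by blast
  have "\<not> card P \<le> 1" using P r by simp
  moreover have "finite P" using P r by (intro card_ge_0_finite) simp
  ultimately obtain A B where AB: "A \<in> P" "B \<in> P" "A \<noteq> B"
    by (auto simp: card_le_Suc0_iff_eq)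
  then obtain a b where ab: "a \<in> A" "b \<in> B" using partition_onD3[OF P(2)] by (metis ex_in_conv)
  define R where "R i = {(x, y). x \<in> V \<and> y \<in> V \<and> linked (color_edges E f i) x y}" for i
  define C where "C = (\<lambda>(i, v). R i `` {v}) ` ({1..k} \<times> {a, b})"
  have VP: "V = \<Union>P" using partition_onD1[OF P(2)] .
  have abV: "a \<in> V" "b \<in> V" using ab AB VP by auto
  have "R i `` {v} \<in> components V (color_edges E f i)" if "v \<in> {a, b}" for i v
    unfolding components_def R_def[symmetric] using that abV by (intro quotientI) blast
  then have "C \<subseteq> mono_components k V E f"
    unfolding C_def mono_components_def by (intro image_subsetI) (auto simp del: insert_iff)
  moreover have "finite C" by (simp add: C_def)
  moreover have "V \<subseteq> \<Union>C"
  proof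
    fix x assume xV: "x \<in> V"
    then obtain X where X: "X \<in> P" "x \<in> X" using VP by blast
    obtain v where v: "v \<in> {a, b}" "\<exists>e\<in>E. v \<in> e \<and> x \<in> e"
    proof (cases "X = A")
      case True
      then show ?thesis
        using complete_partite_edge[OF P(1,2) AB(2) X(1) _ ab(2) X(2)] AB(3) that[of b] E by auto
    next
      case False
      then show ?thesis
        using complete_partite_edge[OF P(1,2) AB(1) X(1) _ ab(1) X(2)] that[of a] E by auto
    qed
    then obtain e where e: "e \<in> E" "v \<in> e" "x \<in> e" by blast
    have "linked (color_edges E f (f e)) v x"
      using e unfolding linked_def color_edges_def by (intro disjI2 exI[of _ "[e]"]) auto
    then have "x \<in> R (f e) `` {v}" using xV v(1) abV by (auto simp: R_def)
    moreover have "f e \<in> {1..k}" using f e by (auto simp: edge_coloring_def)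
    ultimately show "x \<in> \<Union>C" using v(1) unfolding C_def by blast
  qed
  ultimately have "cover_number k V E f \<le> card C"
    unfolding cover_number_def by (intro Least_le) blast
  also have "\<dots> \<le> card ({1..k} \<times> {a, b})" unfolding C_def by (rule card_image_le) simp
  also have "\<dots> \<le> 2 * k" by (simp add: card_cartesian_product card_insert_if)
  finally show ?thesis .
qed

lemma cover_numbers_finite: "2 \<le> r \<Longrightarrow> finite (cover_numbers r k)"
  by (rule finite_subset[of _ "{..2 * k}"]) (auto simp: cover_numbers_def dest: cover_number_le)

lemma cover_numbers_nonempty:
  assumes "1 \<le> k" shows "cover_numbers r k \<noteq> {}"
proof -
  define V where "V = {1..r}"
  define P where "P = (\<lambda>i. {i}) ` V"
  define E where "E = {e. e \<subseteq> V \<and> (\<forall>A\<in>P. card (e \<inter> A) = 1)}"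
  have "partition_on V P" by (auto simp: partition_on_def P_def disjoint_def)
  moreover have "card P = r" by (simp add: P_def V_def card_image)
  ultimately have "complete_partite r V E"
    unfolding complete_partite_def E_def by (auto simp: V_def)
  moreover have "V \<in> E" by (auto simp: E_def P_def)
  then have "spanning V E (\<lambda>_. 1)"
    unfolding spanning_def by fastforce
  moreover have "edge_coloring k E (\<lambda>_. 1)" using assms by (simp add: edge_coloring_def)
  ultimately show ?thesis unfolding cover_numbers_def by blast
qed

end

(* A vertex of class j carries a word of length r + t over {0, ..., t + 1}: its nonzero letters are
   all equal and occupy t positions if j = 0 and one position otherwise. An edge thus has at
   most t + (r - 1) positions with a nonzero letter, so its words all have a 0 in some position; it
   is coloured by a position where its words agree, with preference for a common nonzero letter.
   The words of a monochromatic component of colour i agree at position i. Given t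
   components, some letter y > 0 differs from all their t letters, and the word of class 0 that
   has y at (at least) the positions of those components whose letter is 0 avoids all of them. *)
theory Submission
  imports Defs
begin

section \<open>Set splitting, and functions constant on components\<close>

text \<open>Serves \<open>edge_of_color\<close>, where the positions left over by one word are dealt
  out to the other classes. The induction cuts off one block at a time.\<close>

lemma disjoint_family_of_cards:
  assumes "finite J" and "finite A" and "card A = (\<Sum>j\<in>J. s j)"
  shows "\<exists>T. (\<Union>j\<in>J. T j) = A \<and> (\<forall>j\<in>J. card (T j) = s j) \<and> disjoint_family_on T J"
  using assms
proof (induction J arbitrary: A rule: finite_induct)
  case empty
  then show ?case by (auto simp: disjoint_family_on_def)
next
  case (insert j J)
  from insert.prems insert.hyps have "s j \<le> card A" by simp
  then obtain B where B: "B \<subseteq> A" "card B = s j" by (meson obtain_subset_with_card_n)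
  have "card (A - B) = (\<Sum>j\<in>J. s j)"
    using B insert.prems insert.hyps by (simp add: card_Diff_subset finite_subset)
  then obtain T where T: "(\<Union>j\<in>J. T j) = A - B" "\<forall>j\<in>J. card (T j) = s j" "disjoint_family_on T J"
    using insert.IH[of "A - B"] insert.prems by auto
  have "(\<Union>i\<in>insert j J. (T(j := B)) i) = A"
    using T(1) B(1) insert.hyps by auto
  moreover have "\<forall>i\<in>insert j J. card ((T(j := B)) i) = s i"
    using T(2) B(2) by simp
  moreover have "disjoint_family_on (T(j := B)) (insert j J)"
    using T(1,3) insert.hyps by (auto simp: disjoint_family_on_def)
  ultimately show ?case by blast
qed

text \<open>Consecutive edges of a chain share a vertex, which hands the value of \<open>g\<close>
  on from one edge to the next.\<close>

lemma linked_invariant: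
  assumes inv: "\<And>e u v. e \<in> E \<Longrightarrow> u \<in> e \<Longrightarrow> v \<in> e \<Longrightarrow> g u = g v"
    and "linked E x y"
  shows "g x = g y"
proof -
  have "g x = g y" if "es \<noteq> []" "set es \<subseteq> E" "x \<in> hd es" "y \<in> last es"
    "successively (\<lambda>e e'. e \<inter> e' \<noteq> {}) es" for es x
    using that
  proof (induction es arbitrary: x rule: list_nonempty_induct)
    case (single e)
    then have "e \<in> E" "x \<in> e" "y \<in> e" by simp_all
    then show ?case by (rule inv)
  next
    case (cons e es)
    then obtain z where z: "z \<in> e" "z \<in> hd es" by (auto simp: successively_Cons)
    have "e \<in> E" "x \<in> e" using cons.prems by simp_all
    then have "g x = g z" using inv z(1) by blast
    also have "g z = g y"
      using cons.prems cons.hyps z(2) by (intro cons.IH) (simp_all add: successively_Cons)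
    finally show ?case .
  qed
  then show ?thesis using assms(2) unfolding linked_def by blast
qed

lemma component_invariant:
  assumes "\<And>e u v. e \<in> E \<Longrightarrow> u \<in> e \<Longrightarrow> v \<in> e \<Longrightarrow> g u = g v"
    and "D \<in> components V E"
  shows "\<exists>a. \<forall>v\<in>D. g v = a"
proof -
  obtain x where "D = {(x, y). x \<in> V \<and> y \<in> V \<and> linked E x y} `` {x}"
    using assms(2) unfolding components_def by (elim quotientE)
  then have "g v = g x" if "v \<in> D" for v
    using linked_invariant[where g = g, OF assms(1)] that by fastforce
  then show ?thesis by blast
qed

text \<open>The \<open>LEAST\<close> in \<open>cover_number\<close> is informative only if some
  cover exists; the components of colour 1 alone provide one.\<close>

lemma mono_cover_exists:
  assumes "1 \<le> k" and "finite V"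
  shows "\<exists>m C. C \<subseteq> mono_components k V E f \<and> finite C \<and> card C = m \<and> V \<subseteq> \<Union>C"
proof -
  let ?C = "components V (color_edges E f 1)"
  have "partition_on V ?C" by (rule partition_on_components)
  then have "\<Union>?C = V" "finite ?C"
    using assms(2) by (auto simp: partition_on_def intro: finite_UnionD)
  moreover have "?C \<subseteq> mono_components k V E f"
    using assms(1) unfolding mono_components_def by fastforce
  ultimately show ?thesis by blast
qed

section \<open>The hypergraph of words and its colouring\<close>

definition word_weight :: "nat \<Rightarrow> nat \<Rightarrow> nat" where
  "word_weight t j = (if j = 0 then t else 1)"

lemma sum_word_weight: "1 \<le> r \<Longrightarrow> (\<Sum>j<r. word_weight t j) = t + r - 1"
  by (induction r rule: dec_induct) (auto simp: word_weight_def)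

text \<open>A word is stored as its support \<open>S v\<close> and its common nonzero letter
  \<open>val v\<close>. The vertex type is left abstract, with \<open>rich\<close> saying that every
  admissible word occurs, so that the words can later be numbered by naturals.\<close>

locale word_hypergraph =
  fixes r t :: nat and V :: "'a set" and cls :: "'a \<Rightarrow> nat"
    and S :: "'a \<Rightarrow> nat set" and val :: "'a \<Rightarrow> nat"
  assumes r: "2 \<le> r" and t: "1 \<le> t" and finite_V: "finite V"
    and cls: "v \<in> V \<Longrightarrow> cls v < r"
    and S: "v \<in> V \<Longrightarrow> S v \<subseteq> {1..r + t}"
    and card_S: "v \<in> V \<Longrightarrow> card (S v) = word_weight t (cls v)"
    and val: "v \<in> V \<Longrightarrow> val v \<in> {1..t + 1}"
    and rich: "j < r \<Longrightarrow> A \<subseteq> {1..r + t} \<Longrightarrow> card A = word_weight t j \<Longrightarrow> y \<in> {1..t + 1} \<Longrightarrow>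
      \<exists>v\<in>V. cls v = j \<and> S v = A \<and> val v = y"
begin

lemma val_pos: "v \<in> V \<Longrightarrow> 0 < val v"
  using val[of v] by simp

definition letter :: "'a \<Rightarrow> nat \<Rightarrow> nat" where
  "letter v i = (if i \<in> S v then val v else 0)"

text \<open>The bound on \<open>i\<close> makes every agreeing position a legal colour; beyond it
  all words have letter 0 and would agree trivially.\<close>

definition agree :: "'a set \<Rightarrow> nat \<Rightarrow> nat \<Rightarrow> bool" where
  "agree e i y \<longleftrightarrow> i \<in> {1..r + t} \<and> (\<forall>v\<in>e. letter v i = y)"

definition E :: "'a set set" where
  "E = {e. e \<subseteq> V \<and> (\<forall>j<r. card (e \<inter> {v\<in>V. cls v = j}) = 1)}"

definition color :: "'a set \<Rightarrow> nat" where
  "color e = (if \<exists>i. \<exists>y>0. agree e i y then SOME i. \<exists>y>0. agree e i y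
     else SOME i. agree e i 0)"

lemma class_nonempty: assumes "j < r" shows "\<exists>v\<in>V. cls v = j"
proof -
  have "word_weight t j \<le> card {1..r + t}" using t by (simp add: word_weight_def)
  then obtain A where "A \<subseteq> {1..r + t}" "card A = word_weight t j"
    by (meson obtain_subset_with_card_n)
  then show ?thesis using rich[OF assms, of A 1] by auto
qed

lemma complete: "complete_partite r V E"
proof -
  let ?cl = "\<lambda>j. {v\<in>V. cls v = j}"
  \<comment> \<open>Distinct indices give distinct classes because no class is empty.\<close>
  have "inj_on ?cl {..<r}" using class_nonempty by (fastforce intro!: inj_onI)
  then have "card (?cl ` {..<r}) = r" by (simp add: card_image)
  moreover have "partition_on V (?cl ` {..<r})"
    using class_nonempty cls by (fastforce simp: partition_on_def disjoint_def)
  moreover have "E = {e. e \<subseteq> V \<and> (\<forall>A\<in>?cl ` {..<r}. card (e \<inter> A) = 1)}"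
    by (auto simp: E_def)
  ultimately show ?thesis unfolding complete_partite_def using finite_V by blast
qed

text \<open>Together with \<open>edge_choice\<close>, this lets edges be treated as transversals
  \<open>u\<close> indexed by the classes.\<close>

lemma edge_of_choice:
  assumes "\<And>j. j < r \<Longrightarrow> u j \<in> V" "\<And>j. j < r \<Longrightarrow> cls (u j) = j"
  shows "u ` {..<r} \<in> E"
proof -
  have "u ` {..<r} \<inter> {v\<in>V. cls v = j} = {u j}" if "j < r" for j
    using assms that by auto
  then show ?thesis using assms by (auto simp: E_def)
qed

lemma edge_choice:
  assumes "e \<in> E"
  obtains u where "\<And>j. j < r \<Longrightarrow> u j \<in> V" "\<And>j. j < r \<Longrightarrow> cls (u j) = j" "e = u ` {..<r}"
proof -
  have sub: "e \<subseteq> V" using assms by (simp add: E_def)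
  have "\<exists>w. e \<inter> {v\<in>V. cls v = j} = {w}" if "j < r" for j
    using assms that by (simp add: E_def card_1_singleton_iff)
  then obtain u where u: "\<And>j. j < r \<Longrightarrow> e \<inter> {v\<in>V. cls v = j} = {u j}" by metis
  show ?thesis
  proof (rule that[of u])
    show "u j \<in> V" "cls (u j) = j" if "j < r" for j using u[OF that] by auto
    show "e = u ` {..<r}"
    proof
      show "u ` {..<r} \<subseteq> e" using u by blast
      show "e \<subseteq> u ` {..<r}"
      proof
        fix v assume "v \<in> e"
        then have "cls v < r" "v \<in> e \<inter> {w\<in>V. cls w = cls v}" using sub cls by auto
        then show "v \<in> u ` {..<r}" using u[of "cls v"] by auto
      qed
    qed
  qed
qed

lemma agree_zero: assumes "e \<in> E" shows "\<exists>i. agree e i 0"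
proof -
  obtain u where u: "\<And>j. j < r \<Longrightarrow> u j \<in> V" "\<And>j. j < r \<Longrightarrow> cls (u j) = j" "e = u ` {..<r}"
    using edge_choice[OF assms] by metis
  have "(\<Union>j<r. S (u j)) \<subseteq> {1..r + t}" using u(1) S by blast
  then have fin: "finite (\<Union>j<r. S (u j))" by (rule finite_subset) simp
  have "card (\<Union>j<r. S (u j)) \<le> (\<Sum>j<r. card (S (u j)))" by (intro card_UN_le) simp
  also have "\<dots> = (\<Sum>j<r. word_weight t j)" using u card_S by (intro sum.cong) auto
  also have "\<dots> < card {1..r + t}" using r by (simp add: sum_word_weight)
  finally have "\<not> {1..r + t} \<subseteq> (\<Union>j<r. S (u j))"
    using card_mono[OF fin, of "{1..r + t}"] by linarith
  then show ?thesis using u(3) by (auto simp: agree_def letter_def)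
qed

text \<open>The fallback to the letter 0 in \<open>color\<close> always finds a position, by
  \<open>agree_zero\<close>.\<close>

lemma agree_color: assumes "e \<in> E" shows "\<exists>y. agree e (color e) y"
proof (cases "\<exists>i. \<exists>y>0. agree e i y")
  case True
  then show ?thesis unfolding color_def using someI_ex[OF True] by auto
next
  case False
  then have "color e = (SOME i. agree e i 0)" by (simp only: color_def if_False)
  then show ?thesis using someI_ex[OF agree_zero[OF assms]] by auto
qed

text \<open>A word of class \<open>1\<close> has only one nonzero letter.\<close>

lemma agree_nonzero_unique:
  assumes "e \<in> E" "agree e i y" "agree e i' y'" "0 < y" "0 < y'"
  shows "i = i'"
proof -
  obtain u where u: "\<And>j. j < r \<Longrightarrow> u j \<in> V" "\<And>j. j < r \<Longrightarrow> cls (u j) = j" "e = u ` {..<r}"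
    using edge_choice[OF assms(1)] by metis
  have 1: "1 < r" using r by simp
  have "card (S (u 1)) = 1" using card_S[OF u(1)[OF 1]] u(2)[OF 1] by (simp add: word_weight_def)
  moreover have "u 1 \<in> e" using u(3) 1 by simp
  then have "i \<in> S (u 1)" "i' \<in> S (u 1)" using assms unfolding agree_def letter_def
    by (metis less_irrefl)+
  ultimately show ?thesis by (auto simp: card_1_singleton_iff)
qed

text \<open>Uniqueness of the position forces the choice made by \<open>SOME\<close>.\<close>

lemma color_nonzero:
  assumes "e \<in> E" "agree e i y" "0 < y" shows "color e = i"
proof -
  have *: "\<exists>i. \<exists>y>0. agree e i y" using assms by blast
  then have "\<exists>y>0. agree e (color e) y" unfolding color_def using someI_ex[OF *] by simp
  then show ?thesis using agree_nonzero_unique assms by blast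
qed

section \<open>Every colour occurs at every vertex\<close>

text \<open>If \<open>v\<close> has a nonzero letter at \<open>i\<close>, words with the same letter
  there complete it to an edge of colour \<open>i\<close>. Otherwise the other words are chosen so
  that the supports partition all positions except \<open>i\<close>, which leaves \<open>i\<close>
  as the only position of agreement.\<close>

lemma edge_of_color:
  assumes v: "v \<in> V" and i: "i \<in> {1..r + t}"
  shows "\<exists>e\<in>E. v \<in> e \<and> color e = i"
proof (cases "i \<in> S v")
  case True
  have "\<exists>w\<in>V. cls w = j \<and> i \<in> S w \<and> val w = val v" if "j < r" for j
  proof -
    have "{i} \<subseteq> {1..r + t}" "card {i} \<le> word_weight t j" "word_weight t j \<le> card {1..r + t}"
      using i t by (auto simp: word_weight_def)
    then obtain A where "{i} \<subseteq> A" "A \<subseteq> {1..r + t}" "card A = word_weight t j"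
      by (meson exists_subset_between finite_atLeastAtMost)
    then show ?thesis using rich[OF that, of A "val v"] val[OF v] by auto
  qed
  then obtain w where w: "\<And>j. j < r \<Longrightarrow> w j \<in> V \<and> cls (w j) = j \<and> i \<in> S (w j) \<and> val (w j) = val v"
    by metis
  define u where "u = w(cls v := v)"
  have u: "u j \<in> V \<and> cls (u j) = j \<and> i \<in> S (u j) \<and> val (u j) = val v" if "j < r" for j
    using w[OF that] v True by (auto simp: u_def)
  have E: "u ` {..<r} \<in> E" using u by (intro edge_of_choice) auto
  have "agree (u ` {..<r}) i (val v)" using u i by (auto simp: agree_def letter_def)
  then have "color (u ` {..<r}) = i" using color_nonzero[OF E] val_pos[OF v] by blast
  moreover have "v \<in> u ` {..<r}" using cls[OF v] by (force simp: u_def)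
  ultimately show ?thesis by (intro bexI[OF _ E] conjI)
next
  case False
  let ?J = "{..<r} - {cls v}" and ?A = "{1..r + t} - {i} - S v"
  have fS: "finite (S v)" using finite_subset[OF S[OF v]] by simp
  \<comment> \<open>All weights together are one less than the number of positions, so without
    \<open>i\<close> and \<open>S v\<close> exactly enough positions remain for the other
    classes.\<close>
  have "card ?A = r + t - 1 - word_weight t (cls v)"
    using S[OF v] i False fS card_S[OF v] by (subst card_Diff_subset) auto
  also have "\<dots> = (\<Sum>j\<in>?J. word_weight t j)"
    using r cls[OF v] sum_word_weight[of r t] by (simp add: sum_diff1_nat)
  finally obtain T where T: "(\<Union>j\<in>?J. T j) = ?A" "\<forall>j\<in>?J. card (T j) = word_weight t j"
      "disjoint_family_on T ?J"
    using disjoint_family_of_cards[of ?J ?A "word_weight t"]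
    by (meson finite_Diff finite_atLeastAtMost finite_lessThan)
  have "\<exists>w\<in>V. cls w = j \<and> S w = T j" if "j \<in> ?J" for j
  proof -
    have "T j \<subseteq> {1..r + t}" using T(1) that by blast
    \<comment> \<open>The letter 1 is arbitrary: only the supports matter in this case.\<close>
    then show ?thesis using rich[of j "T j" 1] T(2) that by auto
  qed
  then obtain w where w: "\<And>j. j \<in> ?J \<Longrightarrow> w j \<in> V \<and> cls (w j) = j \<and> S (w j) = T j"
    by metis
  define u where "u = w(cls v := v)"
  have u: "u j \<in> V" "cls (u j) = j" "S (u j) = (T(cls v := S v)) j" if "j < r" for j
    using w[of j] that v by (auto simp: u_def)
  have E: "u ` {..<r} \<in> E" using u by (intro edge_of_choice) auto
  have cover: "\<exists>j<r. i' \<in> S (u j)" if i': "i' \<in> {1..r + t}" "i' \<noteq> i" for i'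
  proof (cases "i' \<in> S v")
    case True
    then show ?thesis using u(3)[of "cls v"] cls[OF v] by auto
  next
    case False
    then obtain j where "j \<in> ?J" "i' \<in> T j" using T(1) i' by blast
    then show ?thesis using u(3)[of j] by auto
  qed
  have disj: "S (u j) \<inter> S (u j') = {}" if "j < r" "j' < r" "j \<noteq> j'" for j j'
  proof -
    have "T l \<inter> S v = {}" if "l \<in> ?J" for l using T(1) that by blast
    moreover have "T j \<inter> T j' = {}" if "j \<in> ?J" "j' \<in> ?J"
      using disjoint_family_onD[OF T(3)] that \<open>j \<noteq> j'\<close> by blast
    ultimately show ?thesis
      using that u(3)[OF that(1)] u(3)[OF that(2)]
      by (cases "j = cls v"; cases "j' = cls v") (simp_all add: Int_commute)
  qed
  obtain y where y: "agree (u ` {..<r}) (color (u ` {..<r})) y" using agree_color[OF E] by blast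
  \<comment> \<open>At any other position exactly one word of the edge is nonzero, so a word of a
    second class disagrees with it.\<close>
  have "color (u ` {..<r}) = i"
  proof (rule ccontr)
    let ?c = "color (u ` {..<r})"
    assume "?c \<noteq> i"
    moreover have "?c \<in> {1..r + t}" using y by (simp add: agree_def)
    ultimately obtain j where j: "j < r" "?c \<in> S (u j)" using cover by blast
    obtain j' where j': "j' < r" "j' \<noteq> j"
      using r that[of 0] that[of 1] by (cases "j = 0") simp_all
    then have "?c \<notin> S (u j')" using disj j by blast
    moreover have "letter (u j) ?c = letter (u j') ?c" using y j j' by (auto simp: agree_def)
    ultimately show False using j val_pos[OF u(1)[OF j(1)]] by (simp add: letter_def)
  qed
  moreover have "v \<in> u ` {..<r}" using cls[OF v] by (force simp: u_def)
  ultimately show ?thesis by (intro bexI[OF _ E] conjI)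
qed

lemma edge_coloring: "edge_coloring (r + t) E color"
  using agree_color unfolding edge_coloring_def agree_def by blast

lemma spanning: "spanning V E color"
  using edge_of_color edge_coloring unfolding spanning_def edge_coloring_def by blast

section \<open>Covers need more than \<open>t\<close> components\<close>

lemma mono_component_letter:
  assumes "D \<in> mono_components (r + t) V E color"
  shows "\<exists>i a. i \<in> {1..r + t} \<and> (\<forall>v\<in>D. letter v i = a)"
proof -
  obtain i where i: "i \<in> {1..r + t}" "D \<in> components V (color_edges E color i)"
    using assms unfolding mono_components_def by blast
  have "letter u i = letter v i" if "e \<in> color_edges E color i" "u \<in> e" "v \<in> e" for e u v
    using agree_color[of e] that by (auto simp: color_edges_def agree_def)
  then have "\<exists>a. \<forall>v\<in>D. letter v i = a" by (intro component_invariant[OF _ i(2)])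
  then show ?thesis using i(1) by blast
qed

lemma not_covered:
  assumes C: "C \<subseteq> mono_components (r + t) V E color" "finite C" "card C \<le> t"
  shows "\<not> V \<subseteq> \<Union>C"
proof -
  obtain i a where ia: "\<And>D. D \<in> C \<Longrightarrow> i D \<in> {1..r + t}"
      "\<And>D v. D \<in> C \<Longrightarrow> v \<in> D \<Longrightarrow> letter v (i D) = a D"
    using mono_component_letter C(1) by (metis subsetD)
  have card_i: "card (i ` C) \<le> t" and card_a: "card (a ` C) \<le> t"
    using C card_image_le le_trans by blast+
  have "i ` C \<subseteq> {1..r + t}" using ia(1) by blast
  with card_i obtain T where T: "i ` C \<subseteq> T" "T \<subseteq> {1..r + t}" "card T = t"
    using exists_subset_between[of "i ` C" t "{1..r + t}"] by force
  \<comment> \<open>Pigeonhole: there are \<open>t + 1\<close> nonzero letters and at most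
    \<open>t\<close> components.\<close>
  have "\<not> {1..t + 1} \<subseteq> a ` C"
    using card_mono[of "a ` C" "{1..t + 1}"] C(2) card_a by auto
  then obtain y where y: "y \<in> {1..t + 1}" "y \<notin> a ` C" by blast
  obtain v where v: "v \<in> V" "S v = T" "val v = y"
    using rich[of 0 T y] T y r by (auto simp: word_weight_def)
  have "v \<notin> D" if "D \<in> C" for D
  proof
    assume "v \<in> D"
    then have "letter v (i D) = a D" using ia(2) that by blast
    moreover have "i D \<in> S v" "a D \<noteq> y" using that T(1) v(2) y(2) by auto
    ultimately show False using v(3) by (simp add: letter_def)
  qed
  then show ?thesis using v(1) by blast
qed

lemma cover_number_gt: "t < cover_number (r + t) V E color"
proof -
  have "1 \<le> r + t" using t by simp
  from LeastI_ex[OF mono_cover_exists[OF this finite_V, of E color], folded cover_number_def]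
  show ?thesis using not_covered by (metis not_le)
qed

end

theorem theorem2p1:
  fixes r t :: nat
  assumes "r \<ge> 3" and "t \<ge> 1"
  shows "cov r (r + t) \<ge> t + 1"
proof -
  \<comment> \<open>All words as triples of class, support and letter. They are numbered by
    \<open>g\<close> because \<open>cover_numbers\<close> ranges over hypergraphs on natural
    numbers.\<close>
  define W where "W = (SIGMA j:{..<r}. {A\<in>Pow {1..r + t}. card A = word_weight t j} \<times> {1..t + 1})"
  have "finite W" by (simp add: W_def)
  then obtain g where "bij_betw g {0..<card W} W" using ex_bij_betw_nat_finite by blast
  then have im: "g ` {0..<card W} = W" by (rule bij_betw_imp_surj_on)
  have gW: "fst (g v) < r" "fst (snd (g v)) \<subseteq> {1..r + t}"
      "card (fst (snd (g v))) = word_weight t (fst (g v))" "snd (snd (g v)) \<in> {1..t + 1}"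
    if "v \<in> {0..<card W}" for v
  proof -
    have "g v \<in> W" using im that by blast
    then show "fst (g v) < r" "fst (snd (g v)) \<subseteq> {1..r + t}"
      "card (fst (snd (g v))) = word_weight t (fst (g v))" "snd (snd (g v)) \<in> {1..t + 1}"
      by (simp_all add: W_def mem_Times_iff split: prod.splits) (auto simp: W_def)
  qed
  interpret word_hypergraph r t "{0..<card W}" "fst \<circ> g" "fst \<circ> snd \<circ> g" "snd \<circ> snd \<circ> g"
  proof
    fix j A y assume "j < r" "A \<subseteq> {1..r + t}" "card A = word_weight t j" "y \<in> {1..t + 1}"
    then have "(j, A, y) \<in> g ` {0..<card W}" unfolding im by (simp add: W_def)
    then obtain v where "v \<in> {0..<card W}" "g v = (j, A, y)" by (metis imageE)
    then show "\<exists>v\<in>{0..<card W}. (fst \<circ> g) v = j \<and> (fst \<circ> snd \<circ> g) v = A \<and> (snd \<circ> snd \<circ> g) v = y"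
      by (intro bexI[of _ v]) simp_all
  qed (use assms gW in \<open>auto simp: Suc_le_eq\<close>)
  have "cover_number (r + t) {0..<card W} E color \<in> cover_numbers r (r + t)"
    unfolding cover_numbers_def using complete edge_coloring spanning by blast
  moreover have "finite (cover_numbers r (r + t))" using assms by (intro cover_numbers_finite) simp
  ultimately have "cover_number (r + t) {0..<card W} E color \<le> cov r (r + t)"
    unfolding cov_def by (intro Max_ge)
  then show ?thesis using cover_number_gt by linarith
qed

end
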